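(* Let $\lambda,r>0$ and $n\ge 1$. For $1\le j\le n$ and $1\le k\le n-j+1$ let $\psi_n(j,k)$ be the probability that the subgraph $\{\ge j\}$ of the exponential random geometric graph $G_n(\lambda,r)$ has exactly $k$ connected components, and let $\zeta_j(n)=1-e^{-\lambda(n-j)r}$ for $1\le j\le n-1$. Then the probability $\psi_n(1,k)$ that there are exactly $k$ components in the graph is obtained from the recursion $$\psi_n(j,k)=\zeta_j(n)\,\psi_n(j+1,k)+(1-\zeta_j(n))\,\psi_n(j+1,k-1),\qquad 1\le j\le n-1,\ 2\le k\le n-j,$$ with initial conditions $$\psi_n(j,n-j+1)=\prod_{i=j}^{n-1}(1-\zeta_i(n)),\qquad \psi_n(j,1)=\prod_{i=j}^{n-1}\zeta_i(n),\qquad 1\le j\le n.$$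
   Context: $G_n(\lambda,r)$ is the random graph with vertex set $\{X_1,\dots,X_n\}$, where $X_1,\dots,X_n$ are i.i.d. exponential random variables with mean $\lambda^{-1}$, and with an edge between $X_i$ and $X_j$ ($i\neq j$) if and only if $|X_i-X_j|\le r$. Let $X_{(1)}\le\dots\le X_{(n)}$ be the order statistics. $\{\ge j\}$ denotes the subgraph induced on the ordered nodes $X_{(j)},\dots,X_{(n)}$. Empty products equal $1$. *)

theory Defs
  imports "HOL-Probability.Probability" "Graph_Theory.Graph_Theory"
begin

text \<open>
  Undirected graphs are represented as symmetric digraphs. A random geometric graph has
  the points themselves as vertices, so coinciding points would be merged into one vertex; for
  the exponential distribution this happens with probability zero, and for \<open>r \<ge> 0\<close> it does
  not affect the number of connected components.
\<close>

definition geometric_graph :: "real \<Rightarrow> real set \<Rightarrow> (real, real \<times> real) pre_digraph" where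
  "geometric_graph r V =
     with_proj \<lparr>pverts = V, parcs = {(x, y) \<in> V \<times> V. x \<noteq> y \<and> \<bar>x - y\<bar> \<le> r}\<rparr>"

definition rgg :: "(nat \<Rightarrow> 'a \<Rightarrow> real) \<Rightarrow> real \<Rightarrow> nat \<Rightarrow> 'a \<Rightarrow> (real, real \<times> real) pre_digraph" where
  "rgg X r n \<omega> = geometric_graph r ((\<lambda>i. X i \<omega>) ` {1..n})"

text \<open>The \<open>j\<close>-th smallest of \<open>X 1 \<omega>, \<dots>, X n \<omega>\<close>, where \<open>1 \<le> j \<le> n\<close>.\<close>

definition order_stat :: "(nat \<Rightarrow> 'a \<Rightarrow> real) \<Rightarrow> nat \<Rightarrow> nat \<Rightarrow> 'a \<Rightarrow> real" where
  "order_stat X n j \<omega> = sort (map (\<lambda>i. X i \<omega>) [1..<Suc n]) ! (j - 1)"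

definition upper_subgraph ::
    "(nat \<Rightarrow> 'a \<Rightarrow> real) \<Rightarrow> real \<Rightarrow> nat \<Rightarrow> nat \<Rightarrow> 'a \<Rightarrow> (real, real \<times> real) pre_digraph" where
  "upper_subgraph X r n j \<omega> =
     induce_subgraph (rgg X r n \<omega>) ((\<lambda>i. order_stat X n i \<omega>) ` {j..n})"

text \<open>
  The name \<open>connected\<close> has to be qualified because the topological notion is also in scope.
\<close>

definition components :: "('v, 'e) pre_digraph \<Rightarrow> ('v, 'e) pre_digraph set" where
  "components G = {H. pre_digraph.max_subgraph G Digraph_Component.connected H}"

definition psi :: "'a measure \<Rightarrow> (nat \<Rightarrow> 'a \<Rightarrow> real) \<Rightarrow> real \<Rightarrow> nat \<Rightarrow> nat \<Rightarrow> nat \<Rightarrow> real" where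
  "psi M X r n j k = measure M {\<omega> \<in> space M. card (components (upper_subgraph X r n j \<omega>)) = k}"

definition zeta :: "real \<Rightarrow> real \<Rightarrow> nat \<Rightarrow> nat \<Rightarrow> real" where
  "zeta l r n j = 1 - exp (- l * (real n - real j) * r)"

definition psi_recursion :: "real \<Rightarrow> real \<Rightarrow> nat \<Rightarrow> (nat \<Rightarrow> nat \<Rightarrow> real) \<Rightarrow> bool" where
  "psi_recursion l r n f \<longleftrightarrow>
     (\<forall>j k. 1 \<le> j \<and> j \<le> n - 1 \<and> 2 \<le> k \<and> k \<le> n - j \<longrightarrow>
        f j k = zeta l r n j * f (j + 1) k + (1 - zeta l r n j) * f (j + 1) (k - 1)) \<and>
     (\<forall>j. 1 \<le> j \<and> j \<le> n \<longrightarrow>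
        f j (n - j + 1) = (\<Prod>i = j..n - 1. 1 - zeta l r n i) \<and>
        f j 1 = (\<Prod>i = j..n - 1. zeta l r n i))"

end

theory Submission
  imports Defs
begin

text \<open>
  Call a point of a finite set \<open>S\<close> of reals a right end if no other point of \<open>S\<close> lies
  within distance \<open>r\<close> to its right. No edge passes over a right end, and the largest point of
  a component is a right end; so the components of the geometric graph on \<open>S\<close> are counted by the
  right ends (\<open>card_components_geometric_graph\<close>). Putting a new smallest point \<open>t\<close> into
  \<open>S\<close> adds one component if the whole of \<open>S\<close> lies beyond \<open>t + r\<close>, and none otherwise
  (\<open>card_right_ends_insert\<close>).

  For \<open>m + 1\<close> independent exponential variables, condition on which one is smallest and on its
  value \<open>t\<close>. By memorylessness (\<open>exponential_sample_memoryless\<close>) the other \<open>m\<close> points,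
  seen from \<open>t\<close>, are again independent exponential variables. Applied a second time at
  \<open>t + r\<close>, memorylessness shows that the event that they all lie beyond \<open>t + r\<close> has probability
  \<open>exp (- l m r)\<close> and is independent of their number of components, a translation invariant
  quantity. Hence the law of the number of components of \<open>m + 1\<close> points is obtained from that of
  \<open>m\<close> points by adding an independent Bernoulli variable (\<open>component_prob\<close>).
  Dropping the smallest of \<open>m + 1\<close> points leaves, up to a translation, a sample of \<open>m\<close>
  points, so the subgraph on the order statistics from the \<open>j\<close>-th on has as many components, in
  law, as a sample of \<open>n - j + 1\<close> points (\<open>measure_card_right_ends_upper_points\<close>,
  \<open>psi_eq_component_prob\<close>). The recursion for \<open>psi\<close> is thus the recursion for
  \<open>component_prob\<close>, and its two boundary values are the products of the
  probabilities that every gap is long, respectively that every gap is short.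
\<close>

section \<open>Components of symmetric digraphs\<close>

text \<open>
  This reduces components to strong components, whose vertex sets are reachability classes.
  A subgraph of a symmetric digraph may itself fail to be symmetric, so connectedness and strong
  connectedness differ for general subgraphs; they agree for induced ones, and passing to the
  induced subgraph preserves connectedness and can only enlarge the subgraph.
\<close>

lemma (in sym_digraph) max_connected_iff_max_strongly_connected:
  "max_subgraph Digraph_Component.connected H \<longleftrightarrow> max_subgraph strongly_connected H"
proof -
  have arc_mono_conn: "arc_mono Digraph_Component.connected"
    unfolding arc_mono_def
    by (metis spanning_def subgraphE wf_digraph.connected_spanning_imp_connected)
  have sc_imp_conn: "Digraph_Component.connected H" if "wf_digraph H" "strongly_connected H" for H
  proof -
    interpret H: wf_digraph H by fact
    show ?thesis
      using that(2) unfolding Digraph_Component.connected_def strongly_connected_def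
      by (auto intro: H.reachable_mk_symmetricI)
  qed
  have conn_imp_sc: "strongly_connected (G \<restriction> verts H)"
    if "Digraph_Component.connected H" "subgraph H G" for H
  proof -
    have ind: "induced_subgraph (G \<restriction> verts H) G" using that by auto
    have sub: "subgraph H (G \<restriction> verts H)" using that(2) by (rule subgraph_induce_subgraphI2)
    have "Digraph_Component.connected (G \<restriction> verts H)"
      using arc_mono_conn that(1) sub unfolding arc_mono_def by fastforce
    moreover have "Digraph.symmetric (G \<restriction> verts H)"
      using sym_arcs ind by (rule induced_graph_imp_symmetric)
    ultimately show ?thesis
      using wf_digraph.symmetric_connected_imp_strongly_connected wf_digraphI_induced[OF ind]
      by blast
  qed
  show ?thesis
  proof
    assume H: "max_subgraph Digraph_Component.connected H"
    then have "G \<restriction> verts H = H"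
      using induced_subgraphI_arc_mono[OF H arc_mono_conn] by (simp add: induce_eq_iff_induced)
    then have "strongly_connected H"
      using conn_imp_sc[of H] H by (auto simp: max_subgraph_def)
    then show "max_subgraph strongly_connected H"
      using H sc_imp_conn unfolding max_subgraph_def by (meson subgraphE)
  next
    assume H: "max_subgraph strongly_connected H"
    show "max_subgraph Digraph_Component.connected H"
    proof (rule max_subgraphI)
      show "Digraph_Component.connected H" "subgraph H G"
        using H sc_imp_conn by (auto simp: max_subgraph_def)
      fix K assume K: "H \<noteq> K" "subgraph H K" "subgraph K G"
      show "\<not> Digraph_Component.connected K"
      proof
        assume "Digraph_Component.connected K"
        then have sc: "strongly_connected (G \<restriction> verts K)" using conn_imp_sc K by blast
        have sub: "subgraph K (G \<restriction> verts K)" using K(3) by (rule subgraph_induce_subgraphI2)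
        have "subgraph H (G \<restriction> verts K)" using K(2) sub by (rule subgraph_trans)
        moreover have "subgraph (G \<restriction> verts K) G" using K(3) by (auto intro: induced_imp_subgraph)
        ultimately have "H = G \<restriction> verts K"
          using H sc unfolding max_subgraph_def by metis
        then have "subgraph K H" using sub by simp
        then have "H = K" using K(2)
          by (auto simp: subgraph_def compatible_def intro!: pre_digraph.equality)
        with K(1) show False ..
      qed
    qed
  qed
qed

lemma (in wf_digraph) card_sccs: "card sccs = card sccs_verts"
  unfolding sccs_conv_sccs_verts
  by (intro card_image inj_onI) (metis induce_subgraph_verts)

section \<open>Components of geometric graphs on the line\<close>

definition right_ends :: "real \<Rightarrow> real set \<Rightarrow> real set" where
  "right_ends r S = {x \<in> S. \<forall>y\<in>S. y \<le> x \<or> x + r < y}"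

lemma sym_digraph_geometric_graph: "sym_digraph (geometric_graph r V)"
proof -
  interpret wf_digraph "geometric_graph r V"
    by unfold_locales (auto simp: geometric_graph_def)
  show ?thesis
    by (rule sym_digraphI) (auto simp: geometric_graph_def Digraph.symmetric_def sym_def abs_minus_commute)
qed

text \<open>
  A path that starts at or below a right end \<open>e\<close> can never pass it, because a vertex at or below
  \<open>e\<close> with a neighbour above \<open>e\<close> would put that neighbour within distance \<open>r\<close> of
  \<open>e\<close>. So distinct right ends lie in distinct components, while the maximum of each component
  is a right end.
\<close>

lemma card_components_geometric_graph:
  assumes "finite V" "0 \<le> r"
  shows "card (components (geometric_graph r V)) = card (right_ends r V)"
proof -
  let ?G = "geometric_graph r V"
  interpret sym_digraph ?G by (rule sym_digraph_geometric_graph)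
  have verts: "verts ?G = V" by (simp add: geometric_graph_def)
  have adj: "x \<rightarrow>\<^bsub>?G\<^esub> y \<longleftrightarrow> x \<in> V \<and> y \<in> V \<and> x \<noteq> y \<and> \<bar>x - y\<bar> \<le> r" for x y
    by (simp add: geometric_graph_def)
  have barrier: "v \<le> e" if e: "e \<in> right_ends r V" and "u \<rightarrow>\<^sup>*\<^bsub>?G\<^esub> v" "u \<le> e" for e u v
    using that(2,3)
  proof (induction rule: reachable_induct)
    case base
    then show ?case by simp
  next
    case (step x y)
    then show ?case using e adj[of x y] by (fastforce simp: right_ends_def)
  qed
  define cmp where "cmp e = {v. e \<rightarrow>\<^sup>*\<^bsub>?G\<^esub> v}" for e
  have cmp: "sccs_verts = cmp ` right_ends r V"
  proof (intro equalityI subsetI)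
    fix C assume C: "C \<in> sccs_verts"
    then have ne: "C \<noteq> {}" and reach: "\<And>u v. u \<in> C \<Longrightarrow> v \<in> C \<Longrightarrow> u \<rightarrow>\<^sup>*\<^bsub>?G\<^esub> v"
      and out: "\<And>u v. u \<in> C \<Longrightarrow> u \<rightarrow>\<^sup>*\<^bsub>?G\<^esub> v \<Longrightarrow> v \<in> C"
      unfolding in_sccs_verts_conv_reachable using symmetric_reachable[OF sym_arcs] by blast+
    have CV: "C \<subseteq> V" using reach reachable_in_verts(1) verts by blast
    then have fin: "finite C" using assms(1) finite_subset by blast
    have mx: "Max C \<in> C" using fin ne by simp
    have "Max C \<in> right_ends r V"
      unfolding right_ends_def
    proof (intro CollectI conjI ballI)
      show "Max C \<in> V" using mx CV by blast
      fix y assume y: "y \<in> V"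
      show "y \<le> Max C \<or> Max C + r < y"
      proof (rule ccontr)
        assume a: "\<not> (y \<le> Max C \<or> Max C + r < y)"
        then have "Max C \<rightarrow>\<^bsub>?G\<^esub> y" using y mx CV by (auto simp: adj)
        then have "y \<in> C" using out[OF mx] by blast
        then show False using a Max_ge[OF fin] by auto
      qed
    qed
    moreover have "C = cmp (Max C)" 
      unfolding cmp_def using reach[OF mx] out[OF mx] by blast
    ultimately show "C \<in> cmp ` right_ends r V" by blast
  next
    fix C assume "C \<in> cmp ` right_ends r V"
    then obtain e where e: "e \<in> V" "C = cmp e" by (auto simp: right_ends_def)
    have "e \<in> cmp e" using e verts by (simp add: cmp_def)
    then show "C \<in> sccs_verts"
      unfolding in_sccs_verts_conv_reachable e(2) cmp_def mem_Collect_eq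
      using reachable_trans symmetric_reachable[OF sym_arcs] by blast
  qed
  have inj: "inj_on cmp (right_ends r V)"
  proof (rule inj_onI)
    fix d e assume d: "d \<in> right_ends r V" and e: "e \<in> right_ends r V" and eq: "cmp d = cmp e"
    have "d \<in> V" "e \<in> V" using d e by (auto simp: right_ends_def)
    then have "d \<rightarrow>\<^sup>*\<^bsub>?G\<^esub> e" "e \<rightarrow>\<^sup>*\<^bsub>?G\<^esub> d"
      using eq verts by (auto simp: cmp_def set_eq_iff)
    then show "d = e" using barrier d e by (meson order.refl antisym)
  qed
  have "components ?G = sccs"
    unfolding components_def sccs_altdef2 max_connected_iff_max_strongly_connected ..
  then show ?thesis using card_sccs cmp card_image[OF inj] by simp
qed

lemma card_right_ends_insert:
  assumes "finite S" "0 \<le> r" "\<forall>y\<in>S. t \<le> y"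
  shows "card (right_ends r (insert t S)) = card (right_ends r S) + of_bool (\<forall>y\<in>S. t + r < y)"
proof (cases "\<forall>y\<in>S. t + r < y")
  case True
  then have "t \<notin> S" using assms(2) by force
  have "right_ends r (insert t S) = insert t (right_ends r S)"
    using True assms(3) by (auto simp: right_ends_def)
  moreover have "t \<notin> right_ends r S" "finite (right_ends r S)"
    using \<open>t \<notin> S\<close> assms(1) by (auto simp: right_ends_def)
  ultimately show ?thesis using True by simp
next
  case False
  then obtain y where y: "y \<in> S" "y \<le> t + r" by (auto simp: not_less)
  have "right_ends r (insert t S) = right_ends r S"
  proof (cases "t \<in> S")
    case True
    then show ?thesis by (simp add: insert_absorb)
  next
    case False
    then have "t < y" using y assms(3) by (metis order_le_less)
    then show ?thesis using y assms(3) False by (fastforce simp: right_ends_def)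
  qed
  then show ?thesis using False by simp
qed

lemma card_right_ends_translate: "card (right_ends r ((\<lambda>u. u - t) ` S)) = card (right_ends r S)"
proof -
  have "right_ends r ((\<lambda>u. u - t) ` S) = (\<lambda>u. u - t) ` right_ends r S"
    by (auto simp: right_ends_def algebra_simps)
  then show ?thesis by (simp add: card_image inj_on_def)
qed

section \<open>The points left after dropping the smallest ones\<close>

text \<open>
  The points that remain when the \<open>m\<close> smallest values of the family are dropped. Counting these
  with multiplicity, as order statistics do, makes removal of a minimal index compatible with
  removal of the smallest value even in the presence of ties.
\<close>

definition upper_points :: "('i \<Rightarrow> real) \<Rightarrow> 'i set \<Rightarrow> nat \<Rightarrow> real set" where
  "upper_points x I m = set (drop m (sorted_list_of_multiset (image_mset x (mset_set I))))"

lemma upper_points_cong: "(\<And>i. i \<in> I \<Longrightarrow> x i = y i) \<Longrightarrow> upper_points x I m = upper_points y I m"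
proof -
  assume "\<And>i. i \<in> I \<Longrightarrow> x i = y i"
  then have "image_mset x (mset_set I) = image_mset y (mset_set I)"
    by (cases "finite I") (auto intro: image_mset_cong)
  then show ?thesis by (simp add: upper_points_def)
qed

lemma upper_points_0: "finite I \<Longrightarrow> upper_points x I 0 = x ` I"
  by (simp add: upper_points_def)

lemma upper_points_empty [simp]: "upper_points x {} m = {}"
  by (simp add: upper_points_def)

lemma upper_points_Suc:
  assumes "finite I" "i \<in> I" "\<forall>j\<in>I. x i \<le> x j"
  shows "upper_points x I (Suc m) = upper_points x (I - {i}) m"
proof -
  have "mset_set I = add_mset i (mset_set (I - {i}))"
    using assms by (simp add: mset_set.remove)
  then have "sorted_list_of_multiset (image_mset x (mset_set I))
      = x i # sorted_list_of_multiset (image_mset x (mset_set (I - {i})))"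
    using assms by (simp add: insort_is_Cons)
  then show ?thesis by (simp add: upper_points_def)
qed

lemma upper_points_translate:
  "upper_points (\<lambda>i. x i - t) I m = (\<lambda>u. u - t) ` upper_points x I m"
proof -
  define ys where "ys = sorted_list_of_multiset (image_mset x (mset_set I))"
  have "sorted (map (\<lambda>u. u - t) ys)"
    by (simp add: ys_def sorted_map sorted_wrt_mono_rel[of _ "(\<le>)"])
  then have "sort (map (\<lambda>u. u - t) ys) = map (\<lambda>u. u - t) ys"
    by (rule sorted_sort_id)
  moreover have "image_mset (\<lambda>i. x i - t) (mset_set I) = mset (map (\<lambda>u. u - t) ys)"
    by (simp add: ys_def multiset.map_comp comp_def)
  ultimately show ?thesis
    unfolding upper_points_def by (simp add: ys_def drop_map del: mset_map)
qed

text \<open>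
  Induction on the index set: the finitely many events that index \<open>i\<close> attains the minimum cover
  the space, and on each of them the count is determined by the count for the remaining indices and
  by comparisons of two variables. The events overlap at ties, where the descriptions agree.
\<close>

lemma measurable_card_right_ends_upper_points:
  assumes "finite I" "0 \<le> r" "\<And>i. i \<in> I \<Longrightarrow> X i \<in> borel_measurable N"
  shows "(\<lambda>\<omega>. card (right_ends r (upper_points (\<lambda>i. X i \<omega>) I m))) \<in> N \<rightarrow>\<^sub>M count_space UNIV"
  using assms(1,3)
proof (induction "card I" arbitrary: I m)
  case 0
  then show ?case by (simp add: right_ends_def)
next
  case (Suc c)
  note [measurable] = Suc.prems(2)
  let ?K = "\<lambda>I m \<omega>. card (right_ends r (upper_points (\<lambda>i. X i \<omega>) I m))"
  define R where "R i \<omega> = (case m of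
      0 \<Rightarrow> ?K (I - {i}) 0 \<omega> + of_bool (\<forall>j\<in>I - {i}. X i \<omega> + r < X j \<omega>)
    | Suc m' \<Rightarrow> ?K (I - {i}) m' \<omega>)" for i \<omega>
  have fin: "finite I" by fact
  have IH [measurable]: "?K (I - {i}) m' \<in> N \<rightarrow>\<^sub>M count_space UNIV" if "i \<in> I" for i m'
    using that Suc by (intro Suc.hyps(1)) auto
  have R_meas [measurable]: "R i \<in> N \<rightarrow>\<^sub>M count_space UNIV" if [measurable]: "i \<in> I" for i
    using fin unfolding R_def by (cases m) (simp_all add: IH)
  have R: "?K I m \<omega> = R i \<omega>" if i: "i \<in> I" "\<forall>j\<in>I. X i \<omega> \<le> X j \<omega>" for i \<omega>
  proof (cases m)
    case 0
    have "(\<lambda>i. X i \<omega>) ` I = insert (X i \<omega>) ((\<lambda>i. X i \<omega>) ` (I - {i}))" using i(1) by blast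
    then show ?thesis
      using 0 i fin assms(2) by (simp add: upper_points_0 card_right_ends_insert R_def)
  next
    case (Suc m')
    then show ?thesis using i fin by (simp add: upper_points_Suc R_def)
  qed
  have "{\<omega> \<in> space N. ?K I m \<omega> = k} \<in> sets N" for k
  proof -
    have "\<exists>i\<in>I. \<forall>j\<in>I. X i \<omega> \<le> X j \<omega>" for \<omega>
    proof -
      have "I \<noteq> {}" using Suc.hyps(2) by auto
      then show ?thesis using fin by (meson arg_min_if_finite(1) arg_min_least)
    qed
    then have "{\<omega> \<in> space N. ?K I m \<omega> = k}
        = (\<Union>i\<in>I. {\<omega> \<in> space N. (\<forall>j\<in>I. X i \<omega> \<le> X j \<omega>) \<and> R i \<omega> = k})"
      using R by fastforce
    also have "\<dots> \<in> sets N"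
    proof (rule sets.finite_UN[OF fin])
      fix i assume [measurable]: "i \<in> I"
      show "{\<omega> \<in> space N. (\<forall>j\<in>I. X i \<omega> \<le> X j \<omega>) \<and> R i \<omega> = k} \<in> sets N"
        using fin by measurable
    qed
    finally show ?thesis .
  qed
  then show ?case
    by (auto simp: measurable_count_space_eq2_countable vimage_def Int_def conj_commute)
qed

section \<open>Memorylessness of exponential samples\<close>

definition exponential_measure :: "real \<Rightarrow> real measure" where
  "exponential_measure l = density lborel (exponential_density l)"

lemma sets_exponential_measure [simp, measurable_cong]: "sets (exponential_measure l) = sets borel"
  by (simp add: exponential_measure_def)

lemma space_exponential_measure [simp]: "space (exponential_measure l) = UNIV"
  by (simp add: exponential_measure_def)

lemma emeasure_exponential_measure_shift:
  assumes l: "0 < l" and t: "0 \<le> t" and A [measurable]: "A \<in> sets borel"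
  shows "emeasure (exponential_measure l) {u. t < u \<and> u - t \<in> A}
       = ennreal (exp (- l * t)) * emeasure (exponential_measure l) A"
proof -
  have "{u. t < u \<and> u - t \<in> A} \<in> sets borel" by measurable
  then have "emeasure (exponential_measure l) {u. t < u \<and> u - t \<in> A}
      = (\<integral>\<^sup>+u. ennreal (exponential_density l u) * indicator {u. t < u \<and> u - t \<in> A} u \<partial>lborel)"
    by (simp add: exponential_measure_def emeasure_density)
  also have "\<dots> = (\<integral>\<^sup>+u. ennreal (exponential_density l (t + u)) * indicator {u. t < u \<and> u - t \<in> A} (t + u) \<partial>lborel)"
    by (subst nn_integral_real_affine[where c=1 and t=t]) auto
  also have "\<dots> = (\<integral>\<^sup>+u. ennreal (exp (- l * t)) * (ennreal (exponential_density l u) * indicator A u) \<partial>lborel)"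
  proof (rule nn_integral_cong_AE)
    have *: "exponential_density l (t + u) = exp (- l * t) * exponential_density l u" if "0 < u" for u
      using t that by (simp add: exponential_density_def exp_add[symmetric] algebra_simps)
    show "AE u in lborel. ennreal (exponential_density l (t + u)) * indicator {u. t < u \<and> u - t \<in> A} (t + u)
      = ennreal (exp (- l * t)) * (ennreal (exponential_density l u) * indicator A u)"
      using AE_lborel_singleton[of 0]
    proof eventually_elim
      case (elim u)
      show ?case
      proof (cases "0 < u")
        case True
        then show ?thesis
          by (simp add: * ennreal_mult' mult.assoc indicator_def)
      next
        case False
        then show ?thesis using elim by (simp add: exponential_density_def)
      qed
    qed
  qed
  also have "\<dots> = ennreal (exp (- l * t)) * emeasure (exponential_measure l) A"
    by (simp add: exponential_measure_def emeasure_density nn_integral_cmult)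
  finally show ?thesis .
qed

lemma prob_space_exponential_measure: "0 < l \<Longrightarrow> prob_space (exponential_measure l)"
  unfolding exponential_measure_def by (rule prob_space_exponential_density)

abbreviation exponential_sample :: "real \<Rightarrow> 'i set \<Rightarrow> ('i \<Rightarrow> real) measure" where
  "exponential_sample l I \<equiv> PiM I (\<lambda>_. exponential_measure l)"

lemma product_prob_space_exponential: "0 < l \<Longrightarrow> product_prob_space (\<lambda>_. exponential_measure l)"
  by (intro product_prob_spaceI prob_space_exponential_measure)

lemma prob_space_exponential_sample: "0 < l \<Longrightarrow> prob_space (exponential_sample l I)"
  by (intro prob_space_PiM prob_space_exponential_measure)

text \<open>
  On boxes this is the one-dimensional lack of memory applied in every coordinate. The general
  case follows because finite product measures are determined by their values on boxes: the sample,
  conditioned on lying above \<open>t\<close> and translated back by \<open>t\<close>, is again the sample.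
\<close>

lemma exponential_sample_memoryless:
  fixes P :: "('i \<Rightarrow> real) \<Rightarrow> bool"
  assumes l: "0 < l" and t: "0 \<le> t" and J: "finite J"
    and meas: "{y \<in> space (exponential_sample l J). P y} \<in> sets (exponential_sample l J)"
    and inv: "\<And>y. y \<in> space (exponential_sample l J) \<Longrightarrow> P (\<lambda>j\<in>J. y j - t) = P y"
  shows "measure (exponential_sample l J) {y \<in> space (exponential_sample l J). (\<forall>j\<in>J. t < y j) \<and> P y}
       = exp (- l * t * card J) * measure (exponential_sample l J) {y \<in> space (exponential_sample l J). P y}"
proof -
  let ?S = "exponential_sample l J"
  let ?above = "{y \<in> space ?S. \<forall>j\<in>J. t < y j}"
  let ?sh = "\<lambda>y. \<lambda>j\<in>J. y j - t"
  define c where "c = exp (- l * t * card J)"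
  interpret product_prob_space "\<lambda>_::'i. exponential_measure l"
    using l by (rule product_prob_space_exponential)
  interpret S: prob_space ?S using l by (rule prob_space_exponential_sample)
  have above [measurable]: "?above \<in> sets ?S" using J by measurable
  have sh [measurable]: "?sh \<in> ?S \<rightarrow>\<^sub>M ?S" by measurable
  \<comment> \<open>the conditional law, given that all coordinates exceed \<open>t\<close>, of the translated sample\<close>
  define Q where "Q = scale_measure (ennreal (1 / c)) (distr (density ?S (indicator ?above)) ?S ?sh)"
  have Q: "emeasure Q B = ennreal (1 / c) * emeasure ?S (?above \<inter> ?sh -` B)"
    if B [measurable]: "B \<in> sets ?S" for B
  proof -
    have "?above \<inter> ?sh -` B = ?above \<inter> (?sh -` B \<inter> space ?S)" by blast
    moreover have "?sh -` B \<inter> space ?S \<in> sets ?S" by measurable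
    ultimately show ?thesis
      by (simp add: Q_def emeasure_distr emeasure_density indicator_inter_arith[symmetric])
  qed
  have "Q = ?S"
  proof (rule PiM_eqI[OF J])
    show "sets Q = sets ?S" by (simp add: Q_def)
    fix A :: "'i \<Rightarrow> real set"
    assume A: "\<And>i. i \<in> J \<Longrightarrow> A i \<in> sets (exponential_measure l)"
    then have A' [measurable]: "\<And>i. i \<in> J \<Longrightarrow> A i \<in> sets borel" by simp
    have box: "?above \<inter> ?sh -` Pi\<^sub>E J A = Pi\<^sub>E J (\<lambda>i. {u. t < u \<and> u - t \<in> A i})"
      by (auto simp: space_PiM PiE_iff extensional_def)
    have "emeasure Q (Pi\<^sub>E J A) = ennreal (1 / c) * emeasure ?S (Pi\<^sub>E J (\<lambda>i. {u. t < u \<and> u - t \<in> A i}))"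
      using A J by (subst Q) (auto simp: box intro!: sets_PiM_I_finite)
    also have "emeasure ?S (Pi\<^sub>E J (\<lambda>i. {u. t < u \<and> u - t \<in> A i}))
        = (\<Prod>i\<in>J. emeasure (exponential_measure l) {u. t < u \<and> u - t \<in> A i})"
    proof (rule emeasure_PiM[OF J])
      fix i assume [measurable]: "i \<in> J"
      show "{u. t < u \<and> u - t \<in> A i} \<in> sets (exponential_measure l)"
        by simp
    qed
    also have "\<dots> = (\<Prod>i\<in>J. ennreal (exp (- l * t)) * emeasure (exponential_measure l) (A i))"
      using A' by (intro prod.cong refl emeasure_exponential_measure_shift l t)
    also have "\<dots> = ennreal c * (\<Prod>i\<in>J. emeasure (exponential_measure l) (A i))"
      by (simp add: prod.distrib c_def ennreal_power exp_of_nat_mult[symmetric] mult_ac)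
    finally show "emeasure Q (Pi\<^sub>E J A) = (\<Prod>i\<in>J. emeasure (exponential_measure l) (A i))"
      by (simp add: mult.assoc[symmetric] ennreal_mult'[symmetric] c_def)
  qed
  then have "emeasure ?S {y \<in> space ?S. P y} = ennreal (1 / c) * emeasure ?S (?above \<inter> ?sh -` {y \<in> space ?S. P y})"
    using Q[OF meas] by simp
  also have "?above \<inter> ?sh -` {y \<in> space ?S. P y} = {y \<in> space ?S. (\<forall>j\<in>J. t < y j) \<and> P y}"
    using inv measurable_space[OF sh] by auto
  finally have "measure ?S {y \<in> space ?S. P y} = 1 / c * measure ?S {y \<in> space ?S. (\<forall>j\<in>J. t < y j) \<and> P y}"
    by (simp add: measure_def enn2real_mult c_def)
  then show ?thesis by (simp add: c_def field_simps)
qed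

section \<open>Conditioning on the minimum of an exponential sample\<close>

lemma nn_integral_exponential_measure:
  assumes "f \<in> borel_measurable borel"
  shows "integral\<^sup>N (exponential_measure l) f = (\<integral>\<^sup>+t. ennreal (exponential_density l t) * f t \<partial>lborel)"
  unfolding exponential_measure_def using assms by (intro nn_integral_density) auto

lemma sets_exponential_sample_strict_min:
  assumes I: "finite I" "i \<in> I" and B [measurable]: "B \<in> sets (exponential_sample l I)"
  shows "{x \<in> B. \<forall>j\<in>I - {i}. x i < x j} \<in> sets (exponential_sample l I)"
proof -
  let ?S = "exponential_sample l I"
  have "{x \<in> space ?S. \<forall>j\<in>I - {i}. x i < x j} \<in> sets ?S"
  proof (rule sets.sets_Collect_finite_All)
    show "finite (I - {i})" using I by simp
    fix j assume "j \<in> I - {i}"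
    then have [measurable]: "j \<in> I" "i \<in> I" using I by auto
    show "{x \<in> space ?S. x i < x j} \<in> sets ?S" by measurable
  qed
  then have "B \<inter> {x \<in> space ?S. \<forall>j\<in>I - {i}. x i < x j} \<in> sets ?S"
    using B by (rule sets.Int[rotated])
  moreover have "{x \<in> B. \<forall>j\<in>I - {i}. x i < x j} = B \<inter> {x \<in> space ?S. \<forall>j\<in>I - {i}. x i < x j}"
    using sets.sets_into_space[OF B] by blast
  ultimately show ?thesis by simp
qed

text \<open>
  Fubini with the coordinate \<open>i\<close> outermost leaves the integral of
  \<open>l exp (- l t) exp (- l t (n - 1)) c\<close> over \<open>t \<ge> 0\<close>, where \<open>n = card I\<close>. Its integrand is
  \<open>c / n\<close> times the exponential density of rate \<open>l n\<close>, the law of the minimum.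
\<close>

lemma measure_exponential_sample_strict_min:
  assumes l: "0 < l" and I: "finite I" "i \<in> I" and A [measurable]: "A \<in> sets (exponential_sample l I)"
    and c: "0 \<le> c"
    and above: "\<And>t. 0 \<le> t \<Longrightarrow>
      measure (exponential_sample l (I - {i}))
        {y \<in> space (exponential_sample l (I - {i})). (\<forall>j\<in>I - {i}. t < y j) \<and> y(i := t) \<in> A}
      = exp (- l * t * card (I - {i})) * c"
  shows "measure (exponential_sample l I) {x \<in> A. \<forall>j\<in>I - {i}. x i < x j} = c / card I"
proof -
  let ?S = "exponential_sample l I" and ?S' = "exponential_sample l (I - {i})"
  let ?B = "{x \<in> A. \<forall>j\<in>I - {i}. x i < x j}"
  let ?n = "card I"
  interpret product_prob_space "\<lambda>_::'a. exponential_measure l"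
    using l by (rule product_prob_space_exponential)
  interpret S: prob_space ?S using l by (rule prob_space_exponential_sample)
  interpret S': prob_space ?S' using l by (rule prob_space_exponential_sample)
  have n: "?n = Suc (card (I - {i}))" using I by (rule card.remove)
  have B [measurable]: "?B \<in> sets ?S" using I A by (rule sets_exponential_sample_strict_min)
  have insI: "insert i (I - {i}) = I" using I by blast
  have "emeasure ?S ?B = integral\<^sup>N ?S (indicator ?B)"
    by (rule nn_integral_indicator[OF B, symmetric])
  also have "\<dots> = integral\<^sup>N (exponential_sample l (insert i (I - {i}))) (indicator ?B)"
    by (simp only: insI)
  also have "\<dots> = (\<integral>\<^sup>+t. (\<integral>\<^sup>+y. indicator ?B (y(i := t)) \<partial>?S') \<partial>exponential_measure l)"
    by (rule product_nn_integral_insert_rev)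
      (use I borel_measurable_indicator[OF B] in \<open>simp_all only: insI finite_Diff Diff_iff singleton_iff simp_thms\<close>)
  also have "\<dots> = (\<integral>\<^sup>+t. ennreal (exponential_density l t) * (\<integral>\<^sup>+y. indicator ?B (y(i := t)) \<partial>?S') \<partial>lborel)"
  proof -
    have "(\<lambda>p. (snd p)(i := fst p)) \<in> borel \<Otimes>\<^sub>M ?S' \<rightarrow>\<^sub>M ?S"
      by (rule measurable_fun_upd[where J="I - {i}"]) (use I in auto)
    from measurable_compose[OF this borel_measurable_indicator[OF B]]
    have "(\<lambda>(t, y). indicator ?B (y(i := t)) :: ennreal) \<in> borel_measurable (borel \<Otimes>\<^sub>M ?S')"
      by (simp only: case_prod_beta')
    then have "(\<lambda>t. \<integral>\<^sup>+y. indicator ?B (y(i := t)) \<partial>?S') \<in> borel_measurable borel"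
      by (rule S'.borel_measurable_nn_integral)
    then show ?thesis by (rule nn_integral_exponential_measure)
  qed
  also have "\<dots> = (\<integral>\<^sup>+t. ennreal (c / ?n) * ennreal (exponential_density (l * ?n) t) \<partial>lborel)"
  proof (rule nn_integral_cong)
    fix t :: real
    show "ennreal (exponential_density l t) * (\<integral>\<^sup>+y. indicator ?B (y(i := t)) \<partial>?S')
        = ennreal (c / ?n) * ennreal (exponential_density (l * ?n) t)"
    proof (cases "0 \<le> t")
      case False
      then show ?thesis by (simp add: exponential_density_def)
    next
      case True
      let ?C = "{y \<in> space ?S'. (\<forall>j\<in>I - {i}. t < y j) \<and> y(i := t) \<in> A}"
      have "(\<lambda>y. y(i := t)) \<in> ?S' \<rightarrow>\<^sub>M ?S"
        by (rule measurable_fun_upd[where J="I - {i}"]) (use I in auto)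
      from measurable_sets[OF this B]
      have "(\<lambda>y. y(i := t)) -` ?B \<inter> space ?S' \<in> sets ?S'" .
      also have "(\<lambda>y. y(i := t)) -` ?B \<inter> space ?S' = ?C" by auto
      finally have C: "?C \<in> sets ?S'" .
      have "(\<integral>\<^sup>+y. indicator ?B (y(i := t)) \<partial>?S') = (\<integral>\<^sup>+y. indicator ?C y \<partial>?S')"
        by (intro nn_integral_cong) (auto simp: indicator_def)
      also have "\<dots> = ennreal (exp (- l * t * card (I - {i})) * c)"
        using C above[OF True] by (simp add: S'.emeasure_eq_measure)
      finally have inner: "(\<integral>\<^sup>+y. indicator ?B (y(i := t)) \<partial>?S') = \<dots>" .
      have q: "real (card (I - {i})) = real ?n - 1" "0 < real ?n" using n by simp_all
      have "exponential_density l t * (exp (- l * t * card (I - {i})) * c)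
          = c / ?n * exponential_density (l * ?n) t"
        using True q(2) unfolding q(1)
        by (simp add: exponential_density_def field_simps exp_add[symmetric])
      then show ?thesis
        using l c unfolding inner
        by (simp add: ennreal_mult'[symmetric] ennreal_mult''[symmetric] exponential_density_nonneg del: ennreal_mult')
    qed
  qed
  also have "\<dots> = ennreal (c / ?n) * emeasure (exponential_measure (l * ?n)) (space (exponential_measure (l * ?n)))"
    by (simp add: exponential_measure_def emeasure_density nn_integral_cmult)
  also have "\<dots> = ennreal (c / ?n)"
    using prob_space.emeasure_space_1[OF prob_space_exponential_measure, of "l * ?n"] l n by simp
  finally show ?thesis using c by (simp add: measure_def)
qed

text \<open>
  Conditioning on the smallest coordinate. The events that \<open>i\<close> is the unique index of the minimum
  are disjoint and contribute \<open>c / card I\<close> each. For the full space, with \<open>c = 1\<close>, they add up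
  to \<open>1\<close>, so the remaining event of a tie at the minimum is negligible.
\<close>

lemma measure_exponential_sample_by_min:
  assumes l: "0 < l" and I: "finite I" "I \<noteq> {}" and A: "A \<in> sets (exponential_sample l I)"
    and c: "0 \<le> c"
    and above: "\<And>i t. i \<in> I \<Longrightarrow> 0 \<le> t \<Longrightarrow>
      measure (exponential_sample l (I - {i}))
        {y \<in> space (exponential_sample l (I - {i})). (\<forall>j\<in>I - {i}. t < y j) \<and> y(i := t) \<in> A}
      = exp (- l * t * card (I - {i})) * c"
  shows "measure (exponential_sample l I) A = c"
proof -
  let ?S = "exponential_sample l I"
  interpret S: prob_space ?S using l by (rule prob_space_exponential_sample)
  have n: "0 < card I" using I by (simp add: card_gt_0_iff)
  have total: "measure ?S (\<Union>i\<in>I. {x \<in> B. \<forall>j\<in>I - {i}. x i < x j}) = b"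
    if B: "B \<in> sets ?S" and b: "0 \<le> b" and ab: "\<And>i t. i \<in> I \<Longrightarrow> 0 \<le> t \<Longrightarrow>
      measure (exponential_sample l (I - {i}))
        {y \<in> space (exponential_sample l (I - {i})). (\<forall>j\<in>I - {i}. t < y j) \<and> y(i := t) \<in> B}
      = exp (- l * t * card (I - {i})) * b" for B b
  proof -
    let ?B = "\<lambda>i. {x \<in> B. \<forall>j\<in>I - {i}. x i < x j}"
    have "?B i \<in> sets ?S" if "i \<in> I" for i
      using I(1) that B by (rule sets_exponential_sample_strict_min)
    moreover have "disjoint_family_on ?B I"
      unfolding disjoint_family_on_def
    proof (intro ballI impI equals0I)
      fix i j x assume ij: "i \<in> I" "j \<in> I" "i \<noteq> j" and x: "x \<in> ?B i \<inter> ?B j"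
      have "x i < x j" "x j < x i" using x ij by auto
      then show False by simp
    qed
    ultimately have "measure ?S (\<Union>i\<in>I. ?B i) = (\<Sum>i\<in>I. measure ?S (?B i))"
      by (intro S.finite_measure_finite_Union[OF I(1)]) blast+
    also have "\<dots> = (\<Sum>i\<in>I. b / card I)"
      by (intro sum.cong refl measure_exponential_sample_strict_min[OF l I(1) _ B b ab])
    finally show ?thesis using n by simp
  qed
  let ?U = "\<lambda>B. \<Union>i\<in>I. {x \<in> B. \<forall>j\<in>I - {i}. x i < x j}"
  have "measure ?S (?U (space ?S)) = 1"
  proof (rule total)
    fix i t assume i: "i \<in> I" and t: "0 \<le> (t::real)"
    let ?S' = "exponential_sample l (I - {i})"
    interpret S': prob_space ?S' using l by (rule prob_space_exponential_sample)
    have "{y \<in> space ?S'. (\<forall>j\<in>I - {i}. t < y j) \<and> y(i := t) \<in> space ?S}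
        = {y \<in> space ?S'. (\<forall>j\<in>I - {i}. t < y j) \<and> True}"
      using i by (auto simp: space_PiM PiE_iff extensional_def)
    then show "measure ?S' {y \<in> space ?S'. (\<forall>j\<in>I - {i}. t < y j) \<and> y(i := t) \<in> space ?S}
      = exp (- l * t * card (I - {i})) * 1"
      using exponential_sample_memoryless[OF l t, of "I - {i}" "\<lambda>_. True"] I S'.prob_space by simp
  qed auto
  moreover have U: "?U B \<in> sets ?S" if B: "B \<in> sets ?S" for B
    using I(1) B by (intro sets.finite_UN sets_exponential_sample_strict_min)
  ultimately have "AE x in ?S. x \<in> ?U (space ?S)"
    by (intro S.AE_prob_1) auto
  then have "measure ?S A = measure ?S (?U A)"
    using A U[OF A] by (intro measure_eq_AE) auto
  also have "\<dots> = c" using total[OF A c above] .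
  finally show ?thesis .
qed

section \<open>The law of the number of components\<close>

text \<open>
  The law of the number of components of a sample of a given size. A sample of size \<open>Suc m\<close> has,
  above its minimum, \<open>m\<close> points, which are all farther than \<open>r\<close> from it with probability
  \<open>exp (- l m r)\<close>. For \<open>m = 0\<close> this probability is \<open>1\<close>, so that the first point always
  opens a component.
\<close>

fun component_prob :: "real \<Rightarrow> real \<Rightarrow> nat \<Rightarrow> nat \<Rightarrow> real" where
  "component_prob l r 0 k = of_bool (k = 0)"
| "component_prob l r (Suc m) k =
     (1 - exp (- l * m * r)) * component_prob l r m k +
     exp (- l * m * r) * (case k of 0 \<Rightarrow> 0 | Suc k' \<Rightarrow> component_prob l r m k')"

lemma component_prob_nonneg: "0 \<le> l \<Longrightarrow> 0 \<le> r \<Longrightarrow> 0 \<le> component_prob l r m k"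
  by (induction m arbitrary: k) (auto split: nat.split intro!: add_nonneg_nonneg mult_nonneg_nonneg)

text \<open>
  Induction on the sample size, splitting off the minimum \<open>t\<close>. If \<open>m > 0\<close>, the minimum is one
  of the dropped points. If \<open>m = 0\<close>, it opens a new component precisely when all other points lie
  beyond \<open>t + r\<close>; memorylessness at \<open>t\<close> and at \<open>t + r\<close> gives the probabilities of the two cases.
\<close>

lemma measure_card_right_ends_upper_points:
  fixes I :: "'i set"
  assumes l: "0 < l" and r: "0 \<le> r" and I: "finite I"
  shows "measure (exponential_sample l I)
      {x \<in> space (exponential_sample l I). card (right_ends r (upper_points x I m)) = k}
    = component_prob l r (card I - m) k"
  using I
proof (induction "card I" arbitrary: I m k)
  case 0
  interpret S: prob_space "exponential_sample l I" using l by (rule prob_space_exponential_sample)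
  have "I = {}" using 0 by simp
  then show ?case using S.prob_space by (cases "k = 0") (simp_all add: right_ends_def)
next
  case (Suc n)
  let ?S = "\<lambda>I::'i set. exponential_sample l I"
  let ?K = "\<lambda>x I m. card (right_ends r (upper_points x I m))"
  have fin: "finite I" and ne: "I \<noteq> {}" using Suc by auto
  have K_meas [measurable]: "(\<lambda>x. ?K x J m) \<in> ?S J \<rightarrow>\<^sub>M count_space UNIV" if "finite J" for J m
    using that r by (intro measurable_card_right_ends_upper_points) auto
  have K_translate: "?K (\<lambda>j\<in>J. y j - t) J m = ?K y J m" for J y t m
    using upper_points_cong[of J "\<lambda>j\<in>J. y j - t" "\<lambda>j. y j - t" m]
    by (simp add: upper_points_translate card_right_ends_translate)
  show ?case
  proof (rule measure_exponential_sample_by_min[OF l fin ne])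
    show "{x \<in> space (?S I). ?K x I m = k} \<in> sets (?S I)" using fin by measurable
    show "0 \<le> component_prob l r (card I - m) k" using l r by (simp add: component_prob_nonneg)
    fix i t assume i: "i \<in> I" and t: "0 \<le> (t::real)"
    let ?J = "I - {i}"
    have finJ: "finite ?J" and J: "card ?J = n" using i fin Suc.hyps(2) by auto
    interpret S': prob_space "?S ?J" using l by (rule prob_space_exponential_sample)
    have IH: "measure (?S ?J) {y \<in> space (?S ?J). ?K y ?J m' = k'} = component_prob l r (n - m') k'" for m' k'
      using Suc.hyps(1)[of ?J m' k'] J finJ by simp
    have memoryless: "measure (?S ?J) {y \<in> space (?S ?J). (\<forall>j\<in>?J. s < y j) \<and> ?K y ?J m' = k'}
        = exp (- l * s * n) * component_prob l r (n - m') k'" if "0 \<le> s" for s m' k'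
      using exponential_sample_memoryless[OF l that finJ, of "\<lambda>y. ?K y ?J m' = k'"] finJ
      by (simp add: IH J K_translate)
    have memoryless_0: "measure (?S ?J) {y \<in> space (?S ?J). (\<forall>j\<in>?J. s < y j) \<and> ?K y ?J 0 = k'}
        = exp (- l * s * n) * component_prob l r n k'" if "0 \<le> s" for s k'
      using memoryless[OF that, of 0 k'] by simp
    have space: "y(i := t) \<in> space (?S I)" if "y \<in> space (?S ?J)" for y
      using that i by (auto simp: space_PiM PiE_iff extensional_def)
    have cong: "upper_points (y(i := t)) ?J m' = upper_points y ?J m'" for y m'
      by (rule upper_points_cong) auto
    show "measure (?S ?J) {y \<in> space (?S ?J). (\<forall>j\<in>?J. t < y j) \<and> y(i := t) \<in> {x \<in> space (?S I). ?K x I m = k}}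
      = exp (- l * t * card ?J) * component_prob l r (card I - m) k" (is "measure _ ?E = _")
    proof (cases m)
      case (Suc m')
      have "?K (y(i := t)) I m = ?K y ?J m'" if "\<forall>j\<in>?J. t < y j" for y
        using that i fin by (subst Suc, subst upper_points_Suc[where i=i]) (auto simp: cong intro: less_imp_le)
      then have "?E = {y \<in> space (?S ?J). (\<forall>j\<in>?J. t < y j) \<and> ?K y ?J m' = k}"
        using space by auto
      then show ?thesis using memoryless[OF t, of m' k] J Suc by (simp add: Suc.hyps(2)[symmetric])
    next
      case 0
      have "?K (y(i := t)) I m = ?K y ?J 0 + of_bool (\<forall>j\<in>?J. t + r < y j)" if "\<forall>j\<in>?J. t < y j" for y
      proof -
        have "(y(i := t)) ` I = insert t (y ` ?J)" using i by auto
        then show ?thesis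
          using that fin r 0 by (simp add: upper_points_0 card_right_ends_insert less_imp_le)
      qed
      then have E: "?E = {y \<in> space (?S ?J). (\<forall>j\<in>?J. t < y j) \<and> ?K y ?J 0 + of_bool (\<forall>j\<in>?J. t + r < y j) = k}"
        using space by auto
      let ?near = "{y \<in> space (?S ?J). (\<forall>j\<in>?J. t < y j) \<and> ?K y ?J 0 = k}
        - {y \<in> space (?S ?J). (\<forall>j\<in>?J. t + r < y j) \<and> ?K y ?J 0 = k}"
      let ?far = "{y \<in> space (?S ?J). (\<forall>j\<in>?J. t + r < y j) \<and> Suc (?K y ?J 0) = k}"
      have "?E = ?near \<union> ?far" "?near \<inter> ?far = {}"
        unfolding E using r by (auto, force+)
      then have "measure (?S ?J) ?E = measure (?S ?J) ?near + measure (?S ?J) ?far"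
        using finJ by (simp only:, intro S'.finite_measure_Union) measurable
      also have "measure (?S ?J) ?near
          = exp (- l * t * n) * component_prob l r n k - exp (- l * (t + r) * n) * component_prob l r n k"
      proof (subst S'.finite_measure_Diff)
        show "{y \<in> space (?S ?J). (\<forall>j\<in>?J. t + r < y j) \<and> ?K y ?J 0 = k}
            \<subseteq> {y \<in> space (?S ?J). (\<forall>j\<in>?J. t < y j) \<and> ?K y ?J 0 = k}"
          using r by force
      qed (use finJ r t in \<open>simp_all add: memoryless_0\<close>)
      also have "measure (?S ?J) ?far
          = exp (- l * (t + r) * n) * (case k of 0 \<Rightarrow> 0 | Suc k' \<Rightarrow> component_prob l r n k')"
        using r t by (cases k) (simp_all add: memoryless_0)
      also have "exp (- l * t * n) * component_prob l r n k - exp (- l * (t + r) * n) * component_prob l r n k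
            + exp (- l * (t + r) * n) * (case k of 0 \<Rightarrow> 0 | Suc k' \<Rightarrow> component_prob l r n k')
          = exp (- l * t * card ?J) * component_prob l r (card I - m) k"
        using J 0 by (simp add: Suc.hyps(2)[symmetric] exp_add[symmetric] algebra_simps)
      finally show ?thesis .
    qed
  qed
qed

lemma induce_geometric_graph:
  "W \<subseteq> V \<Longrightarrow> induce_subgraph (geometric_graph r V) W = geometric_graph r W"
  by (auto simp: induce_subgraph_def geometric_graph_def with_proj_def)

lemma order_stat_image:
  assumes "1 \<le> j" "j \<le> n"
  shows "(\<lambda>i. order_stat X n i \<omega>) ` {j..n} = upper_points (\<lambda>i. X i \<omega>) {1..n} (j - 1)"
proof -
  define xs where "xs = sort (map (\<lambda>i. X i \<omega>) [1..<Suc n])"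
  have len: "length xs = n" by (simp add: xs_def)
  have "mset_set {1..n} = mset [1..<Suc n]"
    by (metis mset_upt atLeastLessThanSuc_atLeastAtMost)
  then have "image_mset (\<lambda>i. X i \<omega>) (mset_set {1..n}) = mset (map (\<lambda>i. X i \<omega>) [1..<Suc n])"
    by simp
  then have "upper_points (\<lambda>i. X i \<omega>) {1..n} (j - 1) = set (drop (j - 1) xs)"
    unfolding upper_points_def xs_def by (simp only: sorted_list_of_multiset_mset)
  also have "\<dots> = (\<lambda>i. xs ! (i - 1)) ` {j..n}"
  proof (intro equalityI subsetI)
    fix u assume "u \<in> set (drop (j - 1) xs)"
    then obtain p where "p < n - (j - 1)" "u = xs ! (j - 1 + p)"
      using len assms by (auto simp: in_set_conv_nth)
    then show "u \<in> (\<lambda>i. xs ! (i - 1)) ` {j..n}"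
      using assms by (intro image_eqI[where x="j + p"]) auto
  next
    fix u assume "u \<in> (\<lambda>i. xs ! (i - 1)) ` {j..n}"
    then obtain i where i: "j \<le> i" "i \<le> n" "u = xs ! (i - 1)" by auto
    then have "u = drop (j - 1) xs ! (i - j)" "i - j < length (drop (j - 1) xs)"
      using assms len by auto
    then show "u \<in> set (drop (j - 1) xs)" by (metis nth_mem)
  qed
  finally show ?thesis by (simp add: order_stat_def xs_def)
qed

lemma upper_subgraph_eq:
  assumes "1 \<le> j" "j \<le> n"
  shows "upper_subgraph X r n j \<omega> = geometric_graph r (upper_points (\<lambda>i. X i \<omega>) {1..n} (j - 1))"
proof -
  have "upper_points (\<lambda>i. X i \<omega>) {1..n} (j - 1) \<subseteq> (\<lambda>i. X i \<omega>) ` {1..n}"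
    using set_drop_subset by (fastforce simp: upper_points_def)
  then show ?thesis
    using assms by (simp add: upper_subgraph_def rgg_def order_stat_image induce_geometric_graph)
qed

lemma finite_upper_points: "finite (upper_points x I m)"
  by (simp add: upper_points_def)

lemma psi_eq_component_prob:
  assumes l: "0 < l" and r: "0 \<le> r" and j: "1 \<le> j" "j \<le> n" and "prob_space M"
    and ind: "prob_space.indep_vars M (\<lambda>_. borel) X {1..n}"
    and dist: "\<And>i. i \<in> {1..n} \<Longrightarrow> distributed M lborel (X i) (exponential_density l)"
  shows "psi M X r n j k = component_prob l r (n - j + 1) k"
proof -
  interpret prob_space M by fact
  let ?I = "{1..n}"
  let ?S = "exponential_sample l ?I"
  let ?Y = "\<lambda>\<omega>. \<lambda>i\<in>?I. X i \<omega>"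
  let ?A = "{x \<in> space ?S. card (right_ends r (upper_points x ?I (j - 1))) = k}"
  have rv: "X i \<in> borel_measurable M" if "i \<in> ?I" for i
    using distributed_measurable[OF dist[OF that]] by simp
  have X: "distr M borel (X i) = exponential_measure l" if "i \<in> ?I" for i
    using distributed_distr_eq_density[OF dist[OF that]]
    by (simp add: exponential_measure_def cong: distr_cong)
  have S: "sets (PiM ?I (\<lambda>_. borel)) = sets ?S" by (intro sets_PiM_cong) auto
  have "distr M (PiM ?I (\<lambda>_. borel)) ?Y = PiM ?I (\<lambda>i. distr M borel (X i))"
    using indep_vars_iff_distr_eq_PiM'[of ?I X "\<lambda>_. borel"] ind rv j by auto
  also have "\<dots> = ?S" using X by (intro PiM_cong) auto
  finally have distr: "distr M ?S ?Y = ?S" using S by (simp cong: distr_cong)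
  have Y: "?Y \<in> M \<rightarrow>\<^sub>M ?S" using rv by (intro measurable_restrict) auto
  have "(\<lambda>x. card (right_ends r (upper_points x ?I (j - 1)))) \<in> ?S \<rightarrow>\<^sub>M count_space UNIV"
    using r by (intro measurable_card_right_ends_upper_points) auto
  then have A: "?A \<in> sets ?S" by measurable
  have "psi M X r n j k = measure M (?Y -` ?A \<inter> space M)"
    unfolding psi_def
  proof (intro arg_cong[where f="measure M"] set_eqI)
    fix \<omega>
    have "upper_points (?Y \<omega>) ?I (j - 1) = upper_points (\<lambda>i. X i \<omega>) ?I (j - 1)"
      by (rule upper_points_cong) simp
    then show "\<omega> \<in> {\<omega> \<in> space M. card (components (upper_subgraph X r n j \<omega>)) = k}
        \<longleftrightarrow> \<omega> \<in> ?Y -` ?A \<inter> space M"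
      using measurable_space[OF Y, of \<omega>] r j
      by (auto simp: upper_subgraph_eq card_components_geometric_graph finite_upper_points)
  qed
  also have "\<dots> = measure (distr M ?S ?Y) ?A" using Y A by (simp add: measure_distr)
  also have "\<dots> = component_prob l r (n - (j - 1)) k"
    unfolding distr by (subst measure_card_right_ends_upper_points[OF l r]) simp_all
  also have "n - (j - 1) = n - j + 1" using j by simp
  finally show ?thesis .
qed

section \<open>The recursion\<close>

lemma component_prob_0: "0 < m \<Longrightarrow> component_prob l r m 0 = 0"
proof (induction m)
  case (Suc m)
  then show ?case by (cases "m = 0") simp_all
qed simp

lemma component_prob_eq_0: "m < k \<Longrightarrow> component_prob l r m k = 0"
  by (induction m arbitrary: k) (auto split: nat.split)

lemma component_prob_diag: "component_prob l r m m = (\<Prod>i<m. exp (- l * real i * r))"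
  by (induction m) (simp_all add: component_prob_eq_0 mult_ac)

lemma component_prob_1: "component_prob l r (Suc m) 1 = (\<Prod>i=1..m. 1 - exp (- l * real i * r))"
proof (induction m)
  case (Suc m)
  have "component_prob l r (Suc (Suc m)) 1
      = (1 - exp (- l * real (Suc m) * r)) * component_prob l r (Suc m) 1"
    by (subst component_prob.simps) (simp add: component_prob_0 del: component_prob.simps)
  then show ?case unfolding Suc.IH by (simp add: mult_ac)
qed simp

text \<open>
  The gap above the \<open>i\<close>-th order statistic is governed by the \<open>n - i\<close> points above it, so
  the products over ranks are products over numbers of points taken in reverse order.
\<close>

lemma prod_reflect:
  fixes f :: "nat \<Rightarrow> real"
  assumes "j \<le> n" "1 \<le> n"
  shows "(\<Prod>i=j..n - 1. f (n - i)) = (\<Prod>i=1..n - j. f i)"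
  by (rule prod.reindex_bij_witness[of _ "\<lambda>i. n - i" "\<lambda>i. n - i"]) (use assms in auto)

lemma zeta_eq: "i \<le> n \<Longrightarrow> zeta l r n i = 1 - exp (- l * real (n - i) * r)"
  by (simp add: zeta_def of_nat_diff)

lemma psi_recursion_component_prob:
  assumes "1 \<le> n" and f: "\<And>j k. 1 \<le> j \<Longrightarrow> j \<le> n \<Longrightarrow> f j k = component_prob l r (n - j + 1) k"
  shows "psi_recursion l r n f"
  unfolding psi_recursion_def
proof (intro conjI allI impI; elim conjE)
  fix j k assume j: "1 \<le> j" "j \<le> n - 1" and k: "2 \<le> k" "k \<le> n - j"
  have "n - (j + 1) + 1 = n - j" using j by simp
  moreover obtain k' where "k = Suc k'" using k by (cases k) auto
  ultimately show "f j k = zeta l r n j * f (j + 1) k + (1 - zeta l r n j) * f (j + 1) (k - 1)"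
    using j by (simp add: f zeta_eq)
next
  fix j assume j: "1 \<le> j" "j \<le> n"
  have "{..<Suc (n - j)} = insert 0 {1..n - j}" by auto
  then have "f j (n - j + 1) = (\<Prod>i=1..n - j. exp (- l * real i * r))"
    using j by (simp add: f component_prob_diag del: component_prob.simps prod.lessThan_Suc)
  also have "\<dots> = (\<Prod>i=j..n - 1. exp (- l * real (n - i) * r))"
    using prod_reflect[OF j(2) assms(1), of "\<lambda>i. exp (- l * real i * r)"] by simp
  also have "\<dots> = (\<Prod>i=j..n - 1. 1 - zeta l r n i)"
    by (intro prod.cong refl) (auto simp: zeta_eq)
  finally show "f j (n - j + 1) = (\<Prod>i=j..n - 1. 1 - zeta l r n i)" .
  have "f j 1 = (\<Prod>i=1..n - j. 1 - exp (- l * real i * r))"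
    using j component_prob_1[of l r "n - j"] by (simp add: f del: component_prob.simps)
  also have "\<dots> = (\<Prod>i=j..n - 1. 1 - exp (- l * real (n - i) * r))"
    using prod_reflect[OF j(2) assms(1), of "\<lambda>i. 1 - exp (- l * real i * r)"] by simp
  also have "\<dots> = (\<Prod>i=j..n - 1. zeta l r n i)"
    by (intro prod.cong refl) (auto simp: zeta_eq)
  finally show "f j 1 = (\<Prod>i=j..n - 1. zeta l r n i)" .
qed

text \<open>
  Decreasing induction on \<open>j\<close>: within the range \<open>1 \<le> k \<le> n - j + 1\<close> the extreme values of
  \<open>k\<close> are boundary values, and all other values lead back to \<open>j + 1\<close> inside its range.
\<close>

lemma psi_recursion_unique:
  assumes f: "psi_recursion l r n f" and g: "psi_recursion l r n g"
    and "1 \<le> j" "j \<le> n" "1 \<le> k" "k \<le> n - j + 1"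
  shows "f j k = g j k"
  using assms(3-)
proof (induction "n - j" arbitrary: j k)
  case 0
  then have "k = 1" by simp
  then show ?case using f g 0 unfolding psi_recursion_def by simp
next
  case (Suc d)
  consider "k = 1" | "k = n - j + 1" | "2 \<le> k" "k \<le> n - j" using Suc.prems by linarith
  then show ?case
  proof cases
    case 1
    then show ?thesis using f g Suc.prems unfolding psi_recursion_def by simp
  next
    case 2
    then show ?thesis using f g Suc.prems unfolding psi_recursion_def by simp
  next
    case 3
    have "f (j + 1) k = g (j + 1) k" "f (j + 1) (k - 1) = g (j + 1) (k - 1)"
      using 3 Suc.hyps(2) Suc.prems by (auto intro!: Suc.hyps(1))
    moreover have "1 \<le> j \<and> j \<le> n - 1 \<and> 2 \<le> k \<and> k \<le> n - j" using 3 Suc.hyps(2) Suc.prems by auto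
    ultimately show ?thesis using f g unfolding psi_recursion_def by metis
  qed
qed

theorem mainTheorem4:
  fixes M :: "'a measure" and X :: "nat \<Rightarrow> 'a \<Rightarrow> real" and l r :: real and n :: nat
  assumes "0 < l" and "0 < r" and "1 \<le> n"
    and "prob_space M"
    and "prob_space.indep_vars M (\<lambda>_. borel) X {1..n}"
    and "\<And>i. i \<in> {1..n} \<Longrightarrow> distributed M lborel (X i) (exponential_density l)"
  shows "psi_recursion l r n (psi M X r n) \<and>
    (\<forall>f. psi_recursion l r n f \<longrightarrow>
      (\<forall>k\<in>{1..n}. f 1 k = measure M {\<omega> \<in> space M. card (components (rgg X r n \<omega>)) = k}))"
proof -
  have psi: "psi_recursion l r n (psi M X r n)"
    using assms(3) psi_eq_component_prob[OF assms(1) less_imp_le[OF assms(2)] _ _ assms(4-6)]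
    by (rule psi_recursion_component_prob)
  have "upper_subgraph X r n 1 \<omega> = rgg X r n \<omega>" for \<omega>
    using assms(3) by (simp add: upper_subgraph_eq upper_points_0 rgg_def)
  then have "psi M X r n 1 k = measure M {\<omega> \<in> space M. card (components (rgg X r n \<omega>)) = k}" for k
    by (simp add: psi_def)
  moreover have "f 1 k = psi M X r n 1 k" if "psi_recursion l r n f" "k \<in> {1..n}" for f k
    using psi_recursion_unique[OF that(1) psi, of 1 k] that(2) assms(3) by simp
  ultimately show ?thesis using psi by simp
qed

end
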